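(* Let $F=F(X)$ be the free group with basis $X=\{x_1,\dots,x_r\}$, let $N$ be a normal subgroup of $F$, $G=F/N$, $\mu:F\to G$ the canonical epimorphism, and $\Gamma=\Gamma(G,X)$ the Cayley graph of $G$. Let $w\in F$. Then for any $g\in G$ and $x\in X$ the value of $\pi_w$ on the edge $e=(g,gx)$ (labeled by $x$) is equal to the coefficient of $g$ in the Fox derivative $(\partial w/\partial x)^\mu\in\mathbb{Z}G$; i.e., for every $x\in X$, $$(\partial w/\partial x)^\mu=\sum_{g\in G}\pi_w(g,gx)\,g .$$
   Context: The Cayley graph $\Gamma(G,X)$ has vertex set $G$ and, for each $g\in G$ and $x\in X$, one positive edge labeled $x$ from $g$ to $gx^\mu$ (written $gx$). Paths in $\Gamma$ may traverse an edge in its positive direction or in its inverse direction; traversing an edge labeled $x$ backwards reads the label $x^{-1}$. For a path $p$, $\pi_p:E(\Gamma)\to\mathbb{Z}$ assigns to each positive edge $e$ the algebraic number of times $p$ traverses $e$ ($+1$ for each positive traversal, $-1$ for each negative one). For $w\in F$, $p_w$ is the unique path in $\Gamma$ starting at $1$ with label $w$, and $\pi_w=\pi_{p_w}$. The free Fox derivative $\partial/\partial x_i:\mathbb{Z}F\to\mathbb{Z}F$ is the unique additive map with $\partial x_j/\partial x_i=\delta_{ij}$ and $\partial(uv)/\partial x_i=(\partial u/\partial x_i)\,\varepsilon(v)+u\,\partial v/\partial x_i$, where $\varepsilon:\mathbb{Z}F\to\mathbb{Z}$ is the augmentation. The superscript $\mu$ denotes the image under the induced ring homomorphism $\mathbb{Z}F\to\mathbb{Z}G$.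 *)

theory Defs
  imports "HOL-Algebra.RingHom" "HOL-Library.Poly_Mapping" "Graph_Theory.Arc_Walk"
begin

section \<open>The free group on a set of generators\<close>

text \<open>The letter \<open>(x, True)\<close> stands for \<open>x\<close> and \<open>(x, False)\<close> for its formal inverse.
  Elements of the free group are the freely reduced words.\<close>

type_synonym 'a letter = "'a \<times> bool"
type_synonym 'a word = "'a letter list"

definition inv_letter :: "'a letter \<Rightarrow> 'a letter" where
  "inv_letter l = (fst l, \<not> snd l)"

definition reduced :: "'a word \<Rightarrow> bool" where
  "reduced = successively (\<lambda>l m. m \<noteq> inv_letter l)"

text \<open>Left multiplication of a reduced word by a letter, with cancellation.\<close>

definition lcons :: "'a letter \<Rightarrow> 'a word \<Rightarrow> 'a word" where
  "lcons l w = (if w \<noteq> [] \<and> hd w = inv_letter l then tl w else l # w)"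

definition free_group :: "'a set \<Rightarrow> 'a word monoid" where
  "free_group X =
     \<lparr>carrier = {w. reduced w \<and> fst ` set w \<subseteq> X},
      monoid.mult = (\<lambda>u v. foldr lcons u v),
      one = []\<rparr>"

definition gen :: "'a \<Rightarrow> 'a word" where
  "gen x = [(x, True)]"

section \<open>Integral group rings\<close>

text \<open>Elements of the group ring are finitely supported integer functions; the product is the
  biadditive extension of the group multiplication.\<close>

definition group_ring :: "('g, 'b) monoid_scheme \<Rightarrow> ('g \<Rightarrow>\<^sub>0 int) ring" where
  "group_ring G =
     \<lparr>carrier = {a. Poly_Mapping.keys a \<subseteq> carrier G},
      monoid.mult = (\<lambda>a b. frag_extend (\<lambda>g. frag_extend (\<lambda>h. frag_of (g \<otimes>\<^bsub>G\<^esub> h)) b) a),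
      one = frag_of \<one>\<^bsub>G\<^esub>,
      zero = 0,
      add = (+)\<rparr>"

definition augmentation :: "('g \<Rightarrow>\<^sub>0 int) \<Rightarrow> int" where
  "augmentation a = (\<Sum>g\<in>Poly_Mapping.keys a. Poly_Mapping.lookup a g)"

definition group_ring_map :: "('g \<Rightarrow> 'h) \<Rightarrow> ('g \<Rightarrow>\<^sub>0 int) \<Rightarrow> ('h \<Rightarrow>\<^sub>0 int)" where
  "group_ring_map \<phi> = frag_extend (\<lambda>g. frag_of (\<phi> g))"

section \<open>Free Fox derivatives\<close>

text \<open>Maps on the group ring are made extensional (\<open>undefined\<close> off the carrier) so that the
  derivative is literally unique; existence and uniqueness are \<open>fox_derivative_ex1\<close> below.\<close>

definition is_fox_derivative ::
    "'a set \<Rightarrow> 'a \<Rightarrow> (('a word \<Rightarrow>\<^sub>0 int) \<Rightarrow> ('a word \<Rightarrow>\<^sub>0 int)) \<Rightarrow> bool" where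
  "is_fox_derivative X x D \<longleftrightarrow>
     (let R = group_ring (free_group X) in
      D \<in> carrier R \<rightarrow>\<^sub>E carrier R \<and>
      (\<forall>a\<in>carrier R. \<forall>b\<in>carrier R. D (a \<oplus>\<^bsub>R\<^esub> b) = D a \<oplus>\<^bsub>R\<^esub> D b) \<and>
      (\<forall>y\<in>X. D (frag_of (gen y)) = (if y = x then \<one>\<^bsub>R\<^esub> else \<zero>\<^bsub>R\<^esub>)) \<and>
      (\<forall>u\<in>carrier R. \<forall>v\<in>carrier R.
         D (u \<otimes>\<^bsub>R\<^esub> v) = frag_cmul (augmentation v) (D u) \<oplus>\<^bsub>R\<^esub> u \<otimes>\<^bsub>R\<^esub> D v))"

definition fox_derivative ::
    "'a set \<Rightarrow> 'a \<Rightarrow> ('a word \<Rightarrow>\<^sub>0 int) \<Rightarrow> ('a word \<Rightarrow>\<^sub>0 int)" where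
  "fox_derivative X x = (THE D. is_fox_derivative X x D)"

section \<open>Cayley graphs, paths and flows\<close>

text \<open>The arc \<open>(g, x)\<close> is the positive edge labelled \<open>x\<close> from \<open>g\<close> to \<open>g x\<^sup>\<mu>\<close>; loops and parallel
  edges with distinct labels are allowed, since \<open>\<mu>\<close> need not be injective on the generators.\<close>

definition cayley_graph ::
    "('g, 'b) monoid_scheme \<Rightarrow> 'a set \<Rightarrow> ('a \<Rightarrow> 'g) \<Rightarrow> ('g, 'g \<times> 'a) pre_digraph" where
  "cayley_graph G X \<iota> =
     \<lparr>verts = carrier G, arcs = carrier G \<times> X,
      tail = fst, head = (\<lambda>(g, x). g \<otimes>\<^bsub>G\<^esub> \<iota> x)\<rparr>"

text \<open>Adjoins to each arc \<open>e\<close>, now \<open>(e, True)\<close>, a formal inverse \<open>(e, False)\<close>. Paths that may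
  traverse edges backwards are the arc walks of the resulting digraph.\<close>

definition with_inverses :: "('v, 'e) pre_digraph \<Rightarrow> ('v, 'e \<times> bool) pre_digraph" where
  "with_inverses \<Gamma> =
     \<lparr>verts = verts \<Gamma>, arcs = arcs \<Gamma> \<times> UNIV,
      tail = (\<lambda>(e, s). if s then tail \<Gamma> e else head \<Gamma> e),
      head = (\<lambda>(e, s). if s then head \<Gamma> e else tail \<Gamma> e)\<rparr>"

definition is_path_from :: "('v, 'e) pre_digraph \<Rightarrow> 'v \<Rightarrow> ('e \<times> bool) list \<Rightarrow> bool" where
  "is_path_from \<Gamma> u p \<longleftrightarrow> (\<exists>v. pre_digraph.awalk (with_inverses \<Gamma>) u p v)"

definition path_label :: "(('g \<times> 'a) \<times> bool) list \<Rightarrow> 'a word" where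
  "path_label = map (\<lambda>((g, x), s). (x, s))"

definition word_path ::
    "('g, 'b) monoid_scheme \<Rightarrow> 'a set \<Rightarrow> ('a \<Rightarrow> 'g) \<Rightarrow> 'a word \<Rightarrow> (('g \<times> 'a) \<times> bool) list" where
  "word_path G X \<iota> w =
     (THE p. is_path_from (cayley_graph G X \<iota>) \<one>\<^bsub>G\<^esub> p \<and> path_label p = w)"

definition path_flow :: "('e \<times> bool) list \<Rightarrow> 'e \<Rightarrow> int" where
  "path_flow p e = int (count_list p (e, True)) - int (count_list p (e, False))"

definition word_flow ::
    "('g, 'b) monoid_scheme \<Rightarrow> 'a set \<Rightarrow> ('a \<Rightarrow> 'g) \<Rightarrow> 'a word \<Rightarrow> 'g \<times> 'a \<Rightarrow> int" where
  "word_flow G X \<iota> w = path_flow (word_path G X \<iota> w)"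

section \<open>Well-definedness\<close>

lemma inv_letter_inv [simp]: "inv_letter (inv_letter l) = l"
  by (simp add: inv_letter_def)

lemma inv_letter_eq_iff [simp]: "inv_letter l = inv_letter m \<longleftrightarrow> l = m"
  by (auto simp: inv_letter_def prod_eq_iff)

lemma fst_inv_letter [simp]: "fst (inv_letter l) = fst l"
  by (simp add: inv_letter_def)

lemma inv_letter_neq [simp]: "inv_letter l \<noteq> l" "l \<noteq> inv_letter l"
  by (auto simp: inv_letter_def prod_eq_iff)

lemma reduced_Nil [simp]: "reduced []"
  by (simp add: reduced_def)

lemma reduced_Cons: "reduced (l # w) \<longleftrightarrow> w = [] \<or> hd w \<noteq> inv_letter l \<and> reduced w"
  by (auto simp: reduced_def successively_Cons)

lemma reduced_lcons: "reduced w \<Longrightarrow> reduced (lcons l w)"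
  by (cases w) (auto simp: lcons_def reduced_Cons)

lemma lcons_inv: "reduced w \<Longrightarrow> lcons l (lcons (inv_letter l) w) = w"
  by (cases w) (auto simp: lcons_def reduced_Cons)

lemma lcons_inv': "reduced w \<Longrightarrow> lcons (inv_letter l) (lcons l w) = w"
  using lcons_inv [of w "inv_letter l"] by simp

lemma lcons_reduced_Cons: "reduced (l # w) \<Longrightarrow> lcons l w = l # w"
  by (auto simp: lcons_def reduced_Cons)

lemma set_lcons: "set (lcons l w) \<subseteq> insert l (set w)"
  by (cases w) (auto simp: lcons_def)

lemma reduced_foldr: "reduced v \<Longrightarrow> reduced (foldr lcons u v)"
  by (induction u) (auto simp: reduced_lcons)

lemma set_foldr: "set (foldr lcons u v) \<subseteq> set u \<union> set v"
proof (induction u)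
  case (Cons l u)
  then show ?case using set_lcons [of l "foldr lcons u v"] by auto
qed simp

lemma fst_set_foldr:
  assumes "fst ` set u \<subseteq> X" "fst ` set v \<subseteq> X"
  shows "fst ` set (foldr lcons u v) \<subseteq> X"
proof -
  have "fst ` set (foldr lcons u v) \<subseteq> fst ` (set u \<union> set v)"
    by (rule image_mono [OF set_foldr])
  then show ?thesis using assms by (simp only: image_Un) (rule subset_trans, assumption, simp)
qed

lemma foldr_lcons_Nil: "reduced u \<Longrightarrow> foldr lcons u [] = u"
proof (induction u)
  case (Cons l u)
  then have "reduced u" by (auto simp: reduced_Cons)
  with Cons show ?case by (simp add: lcons_reduced_Cons)
qed simp

lemma foldr_lcons_lcons:
  "reduced v \<Longrightarrow> foldr lcons (lcons l u) v = lcons l (foldr lcons u v)"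
  by (cases u) (auto simp: lcons_def [of _ "_ # _"] lcons_inv reduced_foldr, simp add: lcons_def)

lemma foldr_lcons_assoc:
  "reduced w \<Longrightarrow> foldr lcons (foldr lcons u v) w = foldr lcons u (foldr lcons v w)"
  by (induction u) (auto simp: foldr_lcons_lcons)

lemma foldr_lcons_inv:
  "reduced v \<Longrightarrow> foldr lcons (map inv_letter (rev u)) (foldr lcons u v) = v"
  by (induction u arbitrary: v) (auto simp: lcons_inv' reduced_foldr)

lemma reduced_inv: "reduced u \<Longrightarrow> reduced (map inv_letter (rev u))"
  unfolding reduced_def successively_map successively_rev
  by (erule successively_mono) auto

lemma group_free_group: "group (free_group X)"
proof (rule groupI)
  show "\<exists>v\<in>carrier (free_group X). v \<otimes>\<^bsub>free_group X\<^esub> u = \<one>\<^bsub>free_group X\<^esub>"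
    if "u \<in> carrier (free_group X)" for u
  proof (rule bexI)
    show "map inv_letter (rev u) \<otimes>\<^bsub>free_group X\<^esub> u = \<one>\<^bsub>free_group X\<^esub>"
      using that foldr_lcons_inv [of "[]" u] by (simp add: free_group_def foldr_lcons_Nil)
    show "map inv_letter (rev u) \<in> carrier (free_group X)"
      using that by (auto simp: free_group_def reduced_inv image_image)
  qed
next
  fix u v assume "u \<in> carrier (free_group X)" "v \<in> carrier (free_group X)"
  then show "u \<otimes>\<^bsub>free_group X\<^esub> v \<in> carrier (free_group X)"
    by (simp add: free_group_def reduced_foldr fst_set_foldr)
qed (auto simp: free_group_def foldr_lcons_assoc)

lemma gen_in_free_group: "x \<in> X \<Longrightarrow> gen x \<in> carrier (free_group X)"
  by (simp add: free_group_def gen_def reduced_def)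

text \<open>The universal property: \<open>free_group X\<close> is free with basis \<open>gen ` X\<close>.\<close>

lemma free_group_universal:
  assumes "group H" and f: "f \<in> X \<rightarrow> carrier H"
  shows "\<exists>!h. h \<in> extensional (carrier (free_group X)) \<inter> hom (free_group X) H \<and>
              (\<forall>x\<in>X. h (gen x) = f x)"
proof -
  interpret H: group H by fact
  interpret F: group "free_group X" by (rule group_free_group)
  define e where "e l = (if snd l then f (fst l) else inv\<^bsub>H\<^esub> f (fst l))" for l
  define k where "k w = foldr (\<lambda>l z. e l \<otimes>\<^bsub>H\<^esub> z) w \<one>\<^bsub>H\<^esub>" for w
  have e: "e l \<in> carrier H" if "fst l \<in> X" for l
    using that f by (auto simp: e_def)
  have k: "k w \<in> carrier H" if "fst ` set w \<subseteq> X" for w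
    using that by (induction w) (auto simp: k_def e)
  have ei: "e l \<otimes>\<^bsub>H\<^esub> (e (inv_letter l) \<otimes>\<^bsub>H\<^esub> z) = z" if "fst l \<in> X" "z \<in> carrier H" for l z
  proof -
    have "f (fst l) \<in> carrier H" using that f by auto
    then have "e l \<otimes>\<^bsub>H\<^esub> e (inv_letter l) = \<one>\<^bsub>H\<^esub>"
      by (auto simp: e_def inv_letter_def)
    then show ?thesis
      using that e by (simp flip: H.m_assoc)
  qed
  have kl: "k (lcons l w) = e l \<otimes>\<^bsub>H\<^esub> k w" if "fst l \<in> X" "fst ` set w \<subseteq> X" for l w
  proof (cases "w \<noteq> [] \<and> hd w = inv_letter l")
    case True
    then obtain v where "w = inv_letter l # v" by (cases w) auto
    then show ?thesis using that ei [of l "k v"] k [of v] by (simp add: lcons_def k_def)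
  next
    case False
    then have "lcons l w = l # w" by (auto simp: lcons_def)
    then show ?thesis by (simp add: k_def)
  qed
  have km: "k (foldr lcons u v) = k u \<otimes>\<^bsub>H\<^esub> k v" if "fst ` set u \<subseteq> X" "fst ` set v \<subseteq> X" for u v
    using that(1)
  proof (induction u)
    case Nil
    then show ?case using k [OF that(2)] by (simp add: k_def)
  next
    case (Cons l u)
    have "fst ` set (foldr lcons u v) \<subseteq> X"
      using Cons.prems that(2) by (simp add: fst_set_foldr)
    then have "k (foldr lcons (l # u) v) = e l \<otimes>\<^bsub>H\<^esub> (k u \<otimes>\<^bsub>H\<^esub> k v)"
      using Cons by (simp add: kl)
    also have "\<dots> = k (l # u) \<otimes>\<^bsub>H\<^esub> k v"
      using Cons.prems e k that(2) k [of u] k [of v] e [of l] by (simp add: k_def H.m_assoc)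
    finally show ?case .
  qed
  show ?thesis
  proof (rule ex1I)
    show "restrict k (carrier (free_group X)) \<in>
            extensional (carrier (free_group X)) \<inter> hom (free_group X) H \<and>
          (\<forall>x\<in>X. restrict k (carrier (free_group X)) (gen x) = f x)"
    proof (intro conjI ballI IntI homI)
      fix u v assume uv: "u \<in> carrier (free_group X)" "v \<in> carrier (free_group X)"
      then have "k (u \<otimes>\<^bsub>free_group X\<^esub> v) = k u \<otimes>\<^bsub>H\<^esub> k v"
        by (simp add: free_group_def km)
      then show "restrict k (carrier (free_group X)) (u \<otimes>\<^bsub>free_group X\<^esub> v) =
            restrict k (carrier (free_group X)) u \<otimes>\<^bsub>H\<^esub> restrict k (carrier (free_group X)) v"
        using uv by simp
    next
      fix x assume x: "x \<in> X"
      then have "f x \<in> carrier H" using f by auto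
      then have "k (gen x) = f x" by (auto simp: k_def gen_def e_def)
      then show "restrict k (carrier (free_group X)) (gen x) = f x"
        using x by (simp add: gen_in_free_group)
    qed (auto simp: k free_group_def)
  next
    fix h assume h: "h \<in> extensional (carrier (free_group X)) \<inter> hom (free_group X) H \<and>
          (\<forall>x\<in>X. h (gen x) = f x)"
    then interpret h: group_hom "free_group X" H h
      by unfold_locales auto
    have "h w = k w" if "w \<in> carrier (free_group X)" for w
      using that
    proof (induction w)
      case Nil
      then show ?case using h.hom_one by (simp add: k_def free_group_def)
    next
      case (Cons l w)
      have w: "w \<in> carrier (free_group X)" and l: "[l] \<in> carrier (free_group X)"
        using Cons.prems by (auto simp: free_group_def reduced_Cons)
      have "l # w = [l] \<otimes>\<^bsub>free_group X\<^esub> w"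
        using Cons.prems by (simp add: free_group_def lcons_reduced_Cons)
      moreover have "h [l] = e l"
      proof (cases "snd l")
        case True
        then show ?thesis using h l
          by (cases l) (auto simp: e_def gen_def free_group_def)
      next
        case False
        then obtain x where x: "l = (x, False)" "x \<in> X"
          using l by (cases l) (auto simp: free_group_def)
        have "[l] \<otimes>\<^bsub>free_group X\<^esub> gen x = \<one>\<^bsub>free_group X\<^esub>"
          using x by (simp add: free_group_def gen_def lcons_def inv_letter_def)
        then have "[l] = inv\<^bsub>free_group X\<^esub> gen x"
          using l gen_in_free_group [OF x(2)] by (simp add: F.inv_equality)
        then show ?thesis using x h gen_in_free_group [OF x(2)] by (simp add: e_def)
      qed
      ultimately show ?case
        using Cons.IH [OF w] h.hom_mult [OF l w] by (metis k_def foldr_Cons comp_apply)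
    qed
    then show "h = restrict k (carrier (free_group X))"
      using h by (intro extensionalityI [of _ "carrier (free_group X)"]) auto
  qed
qed

lemma keys_subset_induct [consumes 1, case_names of zero diff]:
  assumes "a \<in> carrier (group_ring G)"
    and "\<And>g. g \<in> carrier G \<Longrightarrow> P (frag_of g)" "P 0" "\<And>a b. P a \<Longrightarrow> P b \<Longrightarrow> P (a - b)"
  shows "P a"
  using assms(1) unfolding group_ring_def
  by simp (erule frag_induction, use assms in auto)

lemma frag_of_in_group_ring [simp]: "frag_of g \<in> carrier (group_ring G) \<longleftrightarrow> g \<in> carrier G"
  by (simp add: group_ring_def)

lemma group_ring_simps [simp]:
  "\<zero>\<^bsub>group_ring G\<^esub> = 0" "\<one>\<^bsub>group_ring G\<^esub> = frag_of \<one>\<^bsub>G\<^esub>" "a \<oplus>\<^bsub>group_ring G\<^esub> b = a + b"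
  by (simp_all add: group_ring_def)

lemma group_ring_mult_of [simp]:
  "frag_of g \<otimes>\<^bsub>group_ring G\<^esub> frag_of h = frag_of (g \<otimes>\<^bsub>G\<^esub> h)"
  by (simp add: group_ring_def)

lemma frag_extend_fun_add:
  "frag_extend (\<lambda>g. p g + q g) a = frag_extend p a + frag_extend q a"
  by (simp add: frag_extend_def frag_cmul_distrib2 sum.distrib)

lemma frag_extend_fun_minus: "frag_extend (\<lambda>g. - p g) a = - frag_extend p a"
  by (induction a rule: frag_induction [OF subset_UNIV]) (auto simp: frag_extend_diff)

lemma frag_extend_fun_diff:
  "frag_extend (\<lambda>g. p g - q g) a = frag_extend p a - frag_extend q a"
  using frag_extend_fun_add [of p "\<lambda>g. - q g" a] by (simp add: frag_extend_fun_minus)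

lemma frag_extend_fun_zero [simp]: "frag_extend (\<lambda>g. 0) a = 0"
  by (simp add: frag_extend_def)

lemma group_ring_mult_linear:
  "(a + b) \<otimes>\<^bsub>group_ring G\<^esub> c = a \<otimes>\<^bsub>group_ring G\<^esub> c + b \<otimes>\<^bsub>group_ring G\<^esub> c"
  "c \<otimes>\<^bsub>group_ring G\<^esub> (a + b) = c \<otimes>\<^bsub>group_ring G\<^esub> a + c \<otimes>\<^bsub>group_ring G\<^esub> b"
  "(a - b) \<otimes>\<^bsub>group_ring G\<^esub> c = a \<otimes>\<^bsub>group_ring G\<^esub> c - b \<otimes>\<^bsub>group_ring G\<^esub> c"
  "c \<otimes>\<^bsub>group_ring G\<^esub> (a - b) = c \<otimes>\<^bsub>group_ring G\<^esub> a - c \<otimes>\<^bsub>group_ring G\<^esub> b"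
  "0 \<otimes>\<^bsub>group_ring G\<^esub> c = 0" "c \<otimes>\<^bsub>group_ring G\<^esub> 0 = 0"
  by (simp_all add: group_ring_def frag_extend_add frag_extend_diff frag_extend_fun_add
      frag_extend_fun_diff)

lemma group_ring_zero_closed [simp]: "0 \<in> carrier (group_ring G)"
  by (simp add: group_ring_def)

lemma group_ring_plus_closed:
  "a \<in> carrier (group_ring G) \<Longrightarrow> b \<in> carrier (group_ring G) \<Longrightarrow> a + b \<in> carrier (group_ring G)"
  using keys_add [of a b] by (auto simp: group_ring_def)

lemma group_ring_diff_closed:
  "a \<in> carrier (group_ring G) \<Longrightarrow> b \<in> carrier (group_ring G) \<Longrightarrow> a - b \<in> carrier (group_ring G)"
  using keys_diff [of a b] by (auto simp: group_ring_def)

lemma group_ring_cmul_closed: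
  "a \<in> carrier (group_ring G) \<Longrightarrow> frag_cmul c a \<in> carrier (group_ring G)"
  using keys_cmul [of c a] by (auto simp: group_ring_def)

lemma ring_group_ring:
  assumes "group G"
  shows "ring (group_ring G)"
proof -
  interpret G: group G by fact
  note lin = group_ring_mult_linear
  show ?thesis
  proof (intro ringI abelian_groupI monoidI)
    fix a b assume ab: "a \<in> carrier (group_ring G)" "b \<in> carrier (group_ring G)"
    show "a \<oplus>\<^bsub>group_ring G\<^esub> b \<in> carrier (group_ring G)"
      using ab by (simp add: group_ring_plus_closed)
    have "frag_of g \<otimes>\<^bsub>group_ring G\<^esub> b \<in> carrier (group_ring G)" if "g \<in> carrier G" for g
      using ab(2) that by (induction rule: keys_subset_induct) (auto simp: lin group_ring_diff_closed)
    note 1 = this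
    show "a \<otimes>\<^bsub>group_ring G\<^esub> b \<in> carrier (group_ring G)"
      using ab(1) 1 by (induction rule: keys_subset_induct) (auto simp: lin group_ring_diff_closed)
  next
    fix a b c assume abc: "a \<in> carrier (group_ring G)" "b \<in> carrier (group_ring G)"
      "c \<in> carrier (group_ring G)"
    let ?R = "group_ring G"
    have 1: "frag_of g \<otimes>\<^bsub>?R\<^esub> frag_of h \<otimes>\<^bsub>?R\<^esub> c = frag_of g \<otimes>\<^bsub>?R\<^esub> (frag_of h \<otimes>\<^bsub>?R\<^esub> c)"
      if "g \<in> carrier G" "h \<in> carrier G" for g h
      using abc(3) that
      by (induction rule: keys_subset_induct) (auto simp: lin G.m_assoc simp del: group_ring_mult_of,
          auto simp: G.m_assoc)
    have 2: "frag_of g \<otimes>\<^bsub>?R\<^esub> b \<otimes>\<^bsub>?R\<^esub> c = frag_of g \<otimes>\<^bsub>?R\<^esub> (b \<otimes>\<^bsub>?R\<^esub> c)"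
      if "g \<in> carrier G" for g
      using abc(2) that 
      by (induction rule: keys_subset_induct) (auto simp: lin 1 simp del: group_ring_mult_of)
    show "a \<otimes>\<^bsub>?R\<^esub> b \<otimes>\<^bsub>?R\<^esub> c = a \<otimes>\<^bsub>?R\<^esub> (b \<otimes>\<^bsub>?R\<^esub> c)"
      using abc(1) by (induction rule: keys_subset_induct) (auto simp: lin 2)
  next
    fix a assume a: "a \<in> carrier (group_ring G)"
    show "\<one>\<^bsub>group_ring G\<^esub> \<otimes>\<^bsub>group_ring G\<^esub> a = a"
      using a by (induction rule: keys_subset_induct) (auto simp: lin)
    show "a \<otimes>\<^bsub>group_ring G\<^esub> \<one>\<^bsub>group_ring G\<^esub> = a"
      using a by (induction rule: keys_subset_induct) (auto simp: lin)
    show "\<exists>b\<in>carrier (group_ring G). b \<oplus>\<^bsub>group_ring G\<^esub> a = \<zero>\<^bsub>group_ring G\<^esub>"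
      using a by (intro bexI [of _ "- a"]) (auto simp: group_ring_def)
  qed (auto simp: lin add_ac)
qed

lemma group_ring_map_hom:
  assumes "group G" "group H" "\<phi> \<in> hom G H"
  shows "group_ring_map \<phi> \<in> ring_hom (group_ring G) (group_ring H)"
proof -
  interpret group_hom G H \<phi>
    using assms by (simp add: group_hom_def group_hom_axioms_def)
  have d: "group_ring_map \<phi> (a - b) = group_ring_map \<phi> a - group_ring_map \<phi> b" for a b
    by (simp add: group_ring_map_def frag_extend_diff)
  have o: "group_ring_map \<phi> (frag_of g) = frag_of (\<phi> g)" "group_ring_map \<phi> 0 = 0" for g
    by (simp_all add: group_ring_map_def)
  note lin = group_ring_mult_linear
  show ?thesis
  proof (rule ring_hom_memI)
    fix a assume a: "a \<in> carrier (group_ring G)"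
    then show "group_ring_map \<phi> a \<in> carrier (group_ring H)"
      by (induction rule: keys_subset_induct) (auto simp: d o group_ring_diff_closed)
    fix b assume b: "b \<in> carrier (group_ring G)"
    have "group_ring_map \<phi> (frag_of g \<otimes>\<^bsub>group_ring G\<^esub> b) =
          frag_of (\<phi> g) \<otimes>\<^bsub>group_ring H\<^esub> group_ring_map \<phi> b" if "g \<in> carrier G" for g
      using b that by (induction rule: keys_subset_induct) (auto simp: lin d o)
    note 1 = this
    show "group_ring_map \<phi> (a \<otimes>\<^bsub>group_ring G\<^esub> b) =
          group_ring_map \<phi> a \<otimes>\<^bsub>group_ring H\<^esub> group_ring_map \<phi> b"
      using a 1 by (induction rule: keys_subset_induct) (auto simp: lin d o)
    show "group_ring_map \<phi> (a \<oplus>\<^bsub>group_ring G\<^esub> b) =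
          group_ring_map \<phi> a \<oplus>\<^bsub>group_ring H\<^esub> group_ring_map \<phi> b"
      by (simp add: group_ring_map_def frag_extend_add)
  qed (simp add: o)
qed

lemma augmentation_simps:
  "augmentation (frag_of g) = 1" "augmentation 0 = 0"
  "augmentation (a - b) = augmentation a - augmentation b"
proof -
  have eq: "augmentation a = Poly_Mapping.lookup (group_ring_map (\<lambda>_. ()) a) ()"
    for a :: "'x \<Rightarrow>\<^sub>0 int"
    by (simp add: augmentation_def group_ring_map_def frag_extend_def lookup_sum)
  show "augmentation (frag_of g) = 1" "augmentation 0 = 0"
    "augmentation (a - b) = augmentation a - augmentation b"
    by (simp_all add: eq group_ring_map_def frag_extend_diff lookup_minus)
qed

theorem fox_derivative_ex1:
  fixes X :: "'a set"
  shows "\<exists>!D. is_fox_derivative X x D"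
proof -
  let ?F = "free_group X" and ?R = "group_ring (free_group X)"
  interpret F: group ?F by (rule group_free_group)
  interpret R: ring ?R by (rule ring_group_ring) (rule group_free_group)
  note lin = group_ring_mult_linear
  define d :: "'a letter \<Rightarrow> 'a word \<Rightarrow>\<^sub>0 int" where
    "d l = (if fst l = x then if snd l then frag_of [] else - frag_of [l] else 0)" for l
  define k :: "'a word \<Rightarrow> 'a word \<Rightarrow>\<^sub>0 int" where
    "k w = foldr (\<lambda>l z. d l + frag_of [l] \<otimes>\<^bsub>?R\<^esub> z) w 0" for w
  have k_Nil: "k [] = 0" and k_Cons: "k (l # w) = d l + frag_of [l] \<otimes>\<^bsub>?R\<^esub> k w" for l w
    by (simp_all add: k_def)
  have one: "\<one>\<^bsub>?F\<^esub> = []" and L: "[l] \<in> carrier ?F \<longleftrightarrow> fst l \<in> X"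
    and M: "[l] \<otimes>\<^bsub>?F\<^esub> w = lcons l w" for l :: "'a letter" and w
    by (auto simp: free_group_def reduced_def)
  have d: "d l \<in> carrier ?R" if "fst l \<in> X" for l
    using that group_ring_diff_closed [of 0 ?F "frag_of [l]"] F.one_closed
    by (auto simp: d_def L one simp del: frag_of_in_group_ring)
      (auto simp: L one)
  have k: "k w \<in> carrier ?R" if "fst ` set w \<subseteq> X" for w
    using that by (induction w) (auto simp: k_Nil k_Cons d L intro!: group_ring_plus_closed)
  have di: "d l + frag_of [l] \<otimes>\<^bsub>?R\<^esub> d (inv_letter l) = 0" if "fst l \<in> X" for l
  proof -
    have i: "frag_of [l] \<otimes>\<^bsub>?R\<^esub> (- frag_of [inv_letter l]) = - frag_of []"
      using lin(4) [where G = ?F and c = "frag_of [l]" and a = 0 and b = "frag_of [inv_letter l]"]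
      by (simp add: lin M lcons_def)
    have "frag_of [l] \<otimes>\<^bsub>?R\<^esub> frag_of [] = frag_of [l]"
      by (simp add: M lcons_def)
    with i show ?thesis by (auto simp: d_def lin inv_letter_def)
  qed
  have kl: "k (lcons l w) = d l + frag_of [l] \<otimes>\<^bsub>?R\<^esub> k w" if "fst l \<in> X" "fst ` set w \<subseteq> X" for l w
  proof (cases "w \<noteq> [] \<and> hd w = inv_letter l")
    case True
    then obtain v where v: "w = inv_letter l # v" by (cases w) auto
    have kv: "k v \<in> carrier ?R" using that v k by auto
    have "d l + frag_of [l] \<otimes>\<^bsub>?R\<^esub> k w =
          (d l + frag_of [l] \<otimes>\<^bsub>?R\<^esub> d (inv_letter l)) +
          frag_of [l] \<otimes>\<^bsub>?R\<^esub> (frag_of [inv_letter l] \<otimes>\<^bsub>?R\<^esub> k v)"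
      by (simp add: v k_Cons lin add.assoc)
    also have "\<dots> = frag_of [l] \<otimes>\<^bsub>?R\<^esub> frag_of [inv_letter l] \<otimes>\<^bsub>?R\<^esub> k v"
      using di [OF that(1)] that kv by (subst R.m_assoc) (auto simp: L)
    also have "\<dots> = k v"
      using R.l_one [OF kv] by (simp add: M lcons_def one)
    finally show ?thesis by (simp add: v lcons_def)
  next
    case False
    then have "lcons l w = l # w" by (auto simp: lcons_def)
    then show ?thesis by (simp add: k_Cons)
  qed
  have km: "k (u \<otimes>\<^bsub>?F\<^esub> v) = k u + frag_of u \<otimes>\<^bsub>?R\<^esub> k v" if "u \<in> carrier ?F" "v \<in> carrier ?F" for u v
    using that(1)
  proof (induction u)
    case Nil
    then show ?case using R.l_one [OF k [of v]] that(2) by (simp add: k_Nil free_group_def)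
  next
    case (Cons l u)
    have u: "u \<in> carrier ?F" and l: "fst l \<in> X"
      using Cons.prems by (auto simp: free_group_def reduced_Cons)
    have uv: "fst ` set (u \<otimes>\<^bsub>?F\<^esub> v) \<subseteq> X"
      using F.m_closed [OF u that(2)] by (simp add: free_group_def)
    have lu: "l # u = [l] \<otimes>\<^bsub>?F\<^esub> u"
      using Cons.prems by (simp add: M free_group_def lcons_reduced_Cons)
    have kv: "k v \<in> carrier ?R" using that(2) k by (auto simp: free_group_def)
    have "(l # u) \<otimes>\<^bsub>?F\<^esub> v = lcons l (u \<otimes>\<^bsub>?F\<^esub> v)"
      by (simp add: free_group_def)
    then have "k ((l # u) \<otimes>\<^bsub>?F\<^esub> v) =
        d l + frag_of [l] \<otimes>\<^bsub>?R\<^esub> (k u + frag_of u \<otimes>\<^bsub>?R\<^esub> k v)"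
      using Cons.IH [OF u] kl [OF l uv] by simp
    also have "\<dots> = k (l # u) + frag_of [l] \<otimes>\<^bsub>?R\<^esub> (frag_of u \<otimes>\<^bsub>?R\<^esub> k v)"
      by (simp add: k_Cons lin add.assoc)
    also have "\<dots> = k (l # u) + frag_of (l # u) \<otimes>\<^bsub>?R\<^esub> k v"
      using u l kv R.m_assoc [of "frag_of [l]" "frag_of u" "k v"] by (simp add: L flip: lu)
    finally show ?case .
  qed
  define D where "D = restrict (frag_extend k) (carrier ?R)"
  have Dof: "D (frag_of u) = k u" if "u \<in> carrier ?F" for u
    using that by (simp add: D_def)
  have Dadd: "D (a + b) = D a + D b" and Ddiff: "D (a - b) = D a - D b"
    if "a \<in> carrier ?R" "b \<in> carrier ?R" for a b
    using that by (auto simp: D_def frag_extend_add frag_extend_diff group_ring_diff_closed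
        group_ring_plus_closed)
  have D0: "D 0 = 0" by (simp add: D_def)
  have key: "D (u \<otimes>\<^bsub>?R\<^esub> v) = frag_cmul (augmentation v) (D u) + u \<otimes>\<^bsub>?R\<^esub> D v"
    if uv: "u \<in> carrier ?R" "v \<in> carrier ?R" for u v
  proof -
    have 1: "v \<in> carrier ?R \<and>
      D (frag_of g \<otimes>\<^bsub>?R\<^esub> v) = frag_cmul (augmentation v) (k g) + frag_of g \<otimes>\<^bsub>?R\<^esub> D v"
      if g: "g \<in> carrier ?F" for g
      using uv(2)
    proof (induction rule: keys_subset_induct)
      case (of h)
      then show ?case using g by (simp add: Dof km augmentation_simps)
    next
      case (diff a b)
      then have "frag_of g \<otimes>\<^bsub>?R\<^esub> a \<in> carrier ?R" "frag_of g \<otimes>\<^bsub>?R\<^esub> b \<in> carrier ?R"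
        using g by auto
      with diff show ?case
        by (simp add: lin Ddiff augmentation_simps group_ring_diff_closed frag_cmul_diff_distrib)
    qed (simp add: lin D0 augmentation_simps)
    have "u \<in> carrier ?R \<and>
      D (u \<otimes>\<^bsub>?R\<^esub> v) = frag_cmul (augmentation v) (D u) + u \<otimes>\<^bsub>?R\<^esub> D v"
      using uv(1)
    proof (induction rule: keys_subset_induct)
      case (of g)
      then show ?case using 1 by (simp add: Dof)
    next
      case (diff a b)
      then have ab: "a \<otimes>\<^bsub>?R\<^esub> v \<in> carrier ?R" "b \<otimes>\<^bsub>?R\<^esub> v \<in> carrier ?R"
        using uv(2) by auto
      have "frag_cmul c (p - q) = frag_cmul c p - frag_cmul c q" for c and p q :: "'a word \<Rightarrow>\<^sub>0 int"
        by (intro poly_mapping_eqI) (simp add: lookup_minus right_diff_distrib)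
      with diff ab show ?case by (simp add: lin Ddiff group_ring_diff_closed)
    qed (simp add: lin D0)
    then show ?thesis by blast
  qed
  have Dcl: "D a \<in> carrier ?R" if "a \<in> carrier ?R" for a
  proof -
    have "a \<in> carrier ?R \<and> D a \<in> carrier ?R"
      using that
    proof (induction rule: keys_subset_induct)
      case (of g)
      then show ?case using k by (auto simp: Dof free_group_def)
    qed (auto simp: D0 Ddiff group_ring_diff_closed)
    then show ?thesis by blast
  qed
  have "is_fox_derivative X x D"
    unfolding is_fox_derivative_def Let_def
  proof (intro conjI ballI)
    show "D \<in> carrier ?R \<rightarrow>\<^sub>E carrier ?R"
      using Dcl by (auto simp: D_def)
    show "D (frag_of (gen y)) = (if y = x then \<one>\<^bsub>?R\<^esub> else \<zero>\<^bsub>?R\<^esub>)" if "y \<in> X" for y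
      using Dof [OF gen_in_free_group [OF that]]
      by (simp add: gen_def k_Cons k_Nil lin d_def one)
  qed (simp_all add: Dadd key)
  moreover have "E = D" if E: "is_fox_derivative X x E" for E
  proof (rule extensionalityI)
    show "E \<in> extensional (carrier ?R)" "D \<in> extensional (carrier ?R)"
      using E by (auto simp: is_fox_derivative_def Let_def D_def PiE_def)
    have Eadd: "E (a + b) = E a + E b" if "a \<in> carrier ?R" "b \<in> carrier ?R" for a b
      using E that by (simp add: is_fox_derivative_def Let_def)
    have Ekey: "E (u \<otimes>\<^bsub>?R\<^esub> v) = frag_cmul (augmentation v) (E u) + u \<otimes>\<^bsub>?R\<^esub> E v"
      if "u \<in> carrier ?R" "v \<in> carrier ?R" for u v
      using E that by (simp add: is_fox_derivative_def Let_def)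
    have Egen: "E (frag_of [(y, True)]) = d (y, True)" if "y \<in> X" for y
      using E that by (auto simp: is_fox_derivative_def Let_def d_def gen_def one)
    have E0: "E 0 = 0" using Eadd [of 0 0] by simp
    have Ediff: "E (a - b) = E a - E b" if "a \<in> carrier ?R" "b \<in> carrier ?R" for a b
      using Eadd [of "a - b" b] that by (simp add: group_ring_diff_closed)
    have E1: "E (frag_of []) = 0"
    proof -
      have c: "frag_of [] \<in> carrier ?R" by (simp add: free_group_def)
      have "E (frag_of []) \<in> carrier ?R"
        using E c unfolding is_fox_derivative_def Let_def by blast
      then have l1: "frag_of [] \<otimes>\<^bsub>?R\<^esub> E (frag_of []) = E (frag_of [])"
        using R.l_one by (simp add: one)
      have "[] \<otimes>\<^bsub>?F\<^esub> [] = []" by (simp add: free_group_def)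
      then show ?thesis using Ekey [OF c c] l1 by (simp add: augmentation_simps)
    qed
    have Elet: "E (frag_of [l]) = d l" if l: "fst l \<in> X" for l
    proof (cases "snd l")
      case True
      then show ?thesis using Egen [of "fst l"] l by (cases l) auto
    next
      case False
      let ?m = "inv_letter l"
      have m: "E (frag_of [?m]) = d ?m"
        using False Egen [of "fst l"] l by (simp add: inv_letter_def)
      have "E (frag_of ([l] \<otimes>\<^bsub>?F\<^esub> [?m])) = E (frag_of [l]) + frag_of [l] \<otimes>\<^bsub>?R\<^esub> d ?m"
        using Ekey [of "frag_of [l]" "frag_of [?m]"] l by (simp add: L m augmentation_simps)
      moreover have "[l] \<otimes>\<^bsub>?F\<^esub> [?m] = []" by (simp add: M lcons_def)
      ultimately have "E (frag_of [l]) + frag_of [l] \<otimes>\<^bsub>?R\<^esub> d ?m = 0" using E1 by simp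
      with di [OF l] show ?thesis by (metis add_right_cancel)
    qed
    have Ew: "E (frag_of w) = k w" if "w \<in> carrier ?F" for w
      using that
    proof (induction w)
      case Nil
      then show ?case using E1 by (simp add: k_Nil)
    next
      case (Cons l w)
      have w: "w \<in> carrier ?F" and l: "fst l \<in> X"
        using Cons.prems by (auto simp: free_group_def reduced_Cons)
      have "l # w = [l] \<otimes>\<^bsub>?F\<^esub> w"
        using Cons.prems by (simp add: M free_group_def lcons_reduced_Cons)
      then have "E (frag_of (l # w)) = E (frag_of [l] \<otimes>\<^bsub>?R\<^esub> frag_of w)" by simp
      also have "\<dots> = k (l # w)"
        using Ekey [of "frag_of [l]" "frag_of w"] w l Cons.IH
        by (simp add: L Elet k_Cons augmentation_simps del: group_ring_mult_of)
      finally show ?case .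
    qed
    show "E a = D a" if "a \<in> carrier ?R" for a
    proof -
      have "a \<in> carrier ?R \<and> E a = D a"
        using that by (induction rule: keys_subset_induct)
          (auto simp: Ew Dof E0 D0 Ediff Ddiff group_ring_diff_closed)
      then show ?thesis by blast
    qed
  qed
  ultimately show ?thesis by blast
qed

theorem word_path_ex1:
  assumes "group G" and \<iota>: "\<iota> \<in> X \<rightarrow> carrier G" and "fst ` set w \<subseteq> X" and "u \<in> carrier G"
  shows "\<exists>!p. is_path_from (cayley_graph G X \<iota>) u p \<and> path_label p = w"
  using assms(3,4)
proof (induction w arbitrary: u)
  case Nil
  then show ?case
    by (intro ex1I [of _ "[]"]) (auto simp: path_label_def is_path_from_def pre_digraph.awalk_def
        pre_digraph.cas.simps(1) with_inverses_def cayley_graph_def intro!: exI [of _ u])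
next
  case (Cons l w)
  interpret G: group G by fact
  obtain x s where l: "l = (x, s)" "x \<in> X" using Cons.prems by (cases l) auto
  let ?\<Gamma> = "cayley_graph G X \<iota>"
  have \<iota>x: "\<iota> x \<in> carrier G" using l \<iota> by auto
  define v where "v = (if s then u \<otimes>\<^bsub>G\<^esub> \<iota> x else u \<otimes>\<^bsub>G\<^esub> inv\<^bsub>G\<^esub> \<iota> x)"
  define e where "e = ((if s then u else v, x), s)"
  have v: "v \<in> carrier G" using Cons.prems \<iota>x by (auto simp: v_def)
  have step: "is_path_from ?\<Gamma> u (((g, x), s) # p) \<longleftrightarrow> ((g, x), s) = e \<and> is_path_from ?\<Gamma> v p"
    for g p
  proof -
    have "g \<in> carrier G \<and> g \<otimes>\<^bsub>G\<^esub> \<iota> x = u \<longleftrightarrow> g = u \<otimes>\<^bsub>G\<^esub> inv\<^bsub>G\<^esub> \<iota> x"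
      using \<iota>x Cons.prems by (auto simp: G.m_assoc)
    then show ?thesis
      using Cons.prems \<iota>x l v
      by (auto simp: is_path_from_def pre_digraph.awalk_def pre_digraph.cas.simps
          with_inverses_def cayley_graph_def e_def v_def)
  qed
  have ex: "\<exists>!p. is_path_from ?\<Gamma> v p \<and> path_label p = w"
    using Cons v by auto
  then obtain p where p: "is_path_from ?\<Gamma> v p" "path_label p = w" by blast
  show ?case
  proof (rule ex1I [of _ "e # p"])
    show "is_path_from ?\<Gamma> u (e # p) \<and> path_label (e # p) = l # w"
      using step p l by (auto simp: e_def path_label_def)
    fix q assume q: "is_path_from ?\<Gamma> u q \<and> path_label q = l # w"
    then obtain g q' where q': "q = ((g, x), s) # q'" "path_label q' = w"
      using l by (cases q) (auto simp: path_label_def)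
    then show "q = e # p" using q step ex p by auto
  qed
qed

end

theory Submission
  imports Defs
begin

text \<open>Write \<open>w\<close> as a first letter \<open>l\<close> followed by \<open>v\<close>. The product rule gives
  \<open>\<partial>w/\<partial>x = \<partial>l/\<partial>x + l (\<partial>v/\<partial>x)\<close>, while the path of \<open>w\<close> from \<open>h\<close> is one edge followed by the path
  of \<open>v\<close> from \<open>h l\<^sup>\<mu>\<close>. By induction on \<open>w\<close>, with \<open>h\<close> varying, the flow of the path of \<open>w\<close> from \<open>h\<close> is
  therefore given by the coefficients of the translate \<open>h (\<partial>w/\<partial>x)\<^sup>\<mu>\<close>.\<close>

lemma frag_of_mult_minus:
  "frag_of g \<otimes>\<^bsub>group_ring G\<^esub> (- frag_of h) = - frag_of (g \<otimes>\<^bsub>G\<^esub> h)"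
  using group_ring_mult_linear(4)[where c = "frag_of g" and a = 0 and b = "frag_of h"]
  by (simp add: group_ring_mult_linear)

lemma is_fox_derivative_fox_derivative: "is_fox_derivative X x (fox_derivative X x)"
  unfolding fox_derivative_def by (rule theI'[OF fox_derivative_ex1])

lemma fox_derivative_closed:
  "a \<in> carrier (group_ring (free_group X)) \<Longrightarrow>
    fox_derivative X x a \<in> carrier (group_ring (free_group X))"
  using is_fox_derivative_fox_derivative[of X x]
  by (auto simp: is_fox_derivative_def Let_def)

text \<open>A group element has augmentation 1, so the factor \<open>augmentation v\<close>
  disappears and the product rule becomes the crossed homomorphism law on the free group.\<close>

lemma fox_derivative_mult_frag_of:
  assumes "u \<in> carrier (free_group X)" "v \<in> carrier (free_group X)"
  shows "fox_derivative X x (frag_of (u \<otimes>\<^bsub>free_group X\<^esub> v)) =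
    fox_derivative X x (frag_of u) +
    frag_of u \<otimes>\<^bsub>group_ring (free_group X)\<^esub> fox_derivative X x (frag_of v)"
proof -
  have "fox_derivative X x (frag_of u \<otimes>\<^bsub>group_ring (free_group X)\<^esub> frag_of v) =
      frag_cmul (augmentation (frag_of v)) (fox_derivative X x (frag_of u)) +
      frag_of u \<otimes>\<^bsub>group_ring (free_group X)\<^esub> fox_derivative X x (frag_of v)"
    using is_fox_derivative_fox_derivative[of X x] assms
    \<comment> \<open>The simp rule \<open>group_ring_mult_of\<close> would merge the two factors
      before the product rule could match.\<close>
    unfolding is_fox_derivative_def Let_def by (simp del: group_ring_mult_of)
  then show ?thesis by (simp add: augmentation_simps)
qed

text \<open>Differentiating 1 = 1 * 1 gives D 1 = D 1 + D 1. The unit law used here holds only on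
  the carrier, hence the appeal to closure.\<close>

lemma fox_derivative_Nil: "fox_derivative X x (frag_of []) = 0"
proof -
  interpret R: ring "group_ring (free_group X)"
    by (rule ring_group_ring) (rule group_free_group)
  have Nil: "[] \<in> carrier (free_group X)" "[] \<otimes>\<^bsub>free_group X\<^esub> [] = []"
    and one: "\<one>\<^bsub>free_group X\<^esub> = []"
    by (simp_all add: free_group_def)
  have "frag_of [] \<otimes>\<^bsub>group_ring (free_group X)\<^esub> fox_derivative X x (frag_of []) =
      fox_derivative X x (frag_of [])"
    using R.l_one[OF fox_derivative_closed, of "frag_of []"] Nil by (simp add: one)
  with fox_derivative_mult_frag_of[OF Nil(1) Nil(1), of x] show ?thesis
    by (simp add: Nil(2))
qed

text \<open>The definition prescribes values on generators only. For an inverse letter,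
  differentiating y^-1 y = 1 gives D(y^-1) = - y^-1 D(y).\<close>

lemma fox_derivative_letter:
  assumes "y \<in> X"
  shows "fox_derivative X x (frag_of [(y, s)]) =
    (if y = x then if s then frag_of [] else - frag_of [(y, False)] else 0)"
proof -
  have gen: "fox_derivative X x (frag_of [(y, True)]) = (if y = x then frag_of [] else 0)"
    using is_fox_derivative_fox_derivative[of X x] assms
    by (auto simp: is_fox_derivative_def Let_def gen_def free_group_def)
  show ?thesis
  proof (cases s)
    case True
    with gen show ?thesis by simp
  next
    case False
    have "[(y, s)] \<in> carrier (free_group X)" for s
      using assms by (simp add: free_group_def reduced_def)
    moreover have "[(y, False)] \<otimes>\<^bsub>free_group X\<^esub> [(y, True)] = []"
      by (simp add: free_group_def lcons_def inv_letter_def)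
    moreover have "[(y, False)] \<otimes>\<^bsub>free_group X\<^esub> [] = [(y, False)]"
      by (simp add: free_group_def lcons_def)
    ultimately have "fox_derivative X x (frag_of [(y, False)]) +
        (if y = x then frag_of [(y, False)] else 0) = 0"
      using fox_derivative_mult_frag_of[of "[(y, False)]" X "[(y, True)]" x]
      by (auto simp: fox_derivative_Nil gen group_ring_mult_linear)
    with False show ?thesis by (auto simp: eq_neg_iff_add_eq_0)
  qed
qed

text \<open>A backward traversal of the arc \<open>(g, y)\<close> starts at its head and ends at
  \<open>g\<close>. So \<open>g\<close> is the start of the step when \<open>s\<close> holds and its
  end otherwise.\<close>

lemma is_path_from_cayley_graph_ConsD:
  assumes "monoid G" "\<iota> \<in> X \<rightarrow> carrier G"
    and "is_path_from (cayley_graph G X \<iota>) h (((g, y), s) # p)"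
  shows "g \<in> carrier G" "y \<in> X" "h = (if s then g else g \<otimes>\<^bsub>G\<^esub> \<iota> y)"
    "is_path_from (cayley_graph G X \<iota>) (if s then g \<otimes>\<^bsub>G\<^esub> \<iota> y else g) p"
  using assms monoid.m_closed[of G g "\<iota> y"]
  by (auto simp: is_path_from_def pre_digraph.awalk_def pre_digraph.cas.simps
      with_inverses_def cayley_graph_def split: if_splits)

lemma is_path_from_in_carrier:
  "is_path_from (cayley_graph G X \<iota>) h p \<Longrightarrow> h \<in> carrier G"
  by (auto simp: is_path_from_def pre_digraph.awalk_def with_inverses_def cayley_graph_def)

lemma path_flow_Cons:
  "path_flow ((e', s) # p) e = (if e = e' then if s then 1 else -1 else 0) + path_flow p e"
  by (auto simp: path_flow_def)

text \<open>The induction runs over the path, with the word recovered as its label, so no path has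
  to be constructed. The start \<open>h\<close> varies because the remaining path begins at the far
  end of the first edge.\<close>

theorem path_flow_eq_lookup_fox_derivative:
  assumes "group G" and \<phi>: "\<phi> \<in> hom (free_group X) G"
    and "w \<in> carrier (free_group X)"
    and "is_path_from (cayley_graph G X (\<lambda>y. \<phi> (gen y))) h p" "path_label p = w"
  shows "path_flow p (g, x) = Poly_Mapping.lookup
    (frag_of h \<otimes>\<^bsub>group_ring G\<^esub> group_ring_map \<phi> (fox_derivative X x (frag_of w))) g"
  using assms(3-5)
proof (induction p arbitrary: h w)
  case Nil
  then show ?case
    by (simp add: path_label_def path_flow_def fox_derivative_Nil group_ring_map_def
        group_ring_mult_linear)
next
  case (Cons e p)
  let ?F = "free_group X" and ?\<Gamma> = "cayley_graph G X (\<lambda>y. \<phi> (gen y))"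
  let ?D = "\<lambda>v. group_ring_map \<phi> (fox_derivative X x (frag_of v))"
  interpret G: group G by fact
  interpret R: ring "group_ring G" by (rule ring_group_ring) fact
  interpret \<phi>: group_hom ?F G \<phi>
    using assms by (simp add: group_hom_def group_hom_axioms_def group_free_group)
  have map_hom: "group_ring_map \<phi> \<in> ring_hom (group_ring ?F) (group_ring G)"
    by (rule group_ring_map_hom[OF group_free_group assms(1,2)])
  have \<iota>: "(\<lambda>y. \<phi> (gen y)) \<in> X \<rightarrow> carrier G"
    by (auto intro!: hom_in_carrier[OF \<phi>] gen_in_free_group)
  obtain k y s where e: "e = ((k, y), s)" by (metis prod.exhaust)
  define l where "l = (y, s)"
  define v where "v = path_label p"
  have w: "w = l # v" using Cons.prems(3) by (simp add: e l_def v_def path_label_def)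
  note step = is_path_from_cayley_graph_ConsD[OF G.is_monoid \<iota> Cons.prems(2)[unfolded e]]
  have h: "h \<in> carrier G" using Cons.prems(2) by (rule is_path_from_in_carrier)
  \<comment> \<open>As \<open>w\<close> is reduced, prepending \<open>l\<close> to \<open>v\<close>
    causes no cancellation, so \<open>w\<close> is also the product in the free group.\<close>
  have l: "[l] \<in> carrier ?F" and v: "v \<in> carrier ?F" and lv: "w = [l] \<otimes>\<^bsub>?F\<^esub> v"
    using Cons.prems(1) step(2) unfolding w l_def
    by (auto simp: free_group_def reduced_Cons lcons_reduced_Cons)
  have \<phi>l: "\<phi> [l] = (if s then \<phi> (gen y) else inv\<^bsub>G\<^esub> \<phi> (gen y))"
  proof (cases s)
    case False
    have "[l] \<otimes>\<^bsub>?F\<^esub> gen y = \<one>\<^bsub>?F\<^esub>"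
      using False by (simp add: l_def free_group_def gen_def lcons_def inv_letter_def)
    then have "[l] = inv\<^bsub>?F\<^esub> gen y"
      using l gen_in_free_group[OF step(2)] by (simp add: \<phi>.inv_equality)
    with False show ?thesis using gen_in_free_group[OF step(2)] by simp
  qed (simp add: l_def gen_def)
  \<comment> \<open>This is the vertex reached by the first step. In the backward case
    \<open>h\<close> is \<open>k\<close> times the image of \<open>y\<close>, and the inverse
    cancels that image.\<close>
  have target: "h \<otimes>\<^bsub>G\<^esub> \<phi> [l] = (if s then k \<otimes>\<^bsub>G\<^esub> \<phi> (gen y) else k)"
    using step(1,3) gen_in_free_group[OF step(2)] by (simp add: \<phi>l G.m_assoc)
  have cv: "?D v \<in> carrier (group_ring G)"
    using v by (intro ring_hom_closed[OF map_hom] fox_derivative_closed) simp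
  have "?D w = ?D [l] + frag_of (\<phi> [l]) \<otimes>\<^bsub>group_ring G\<^esub> ?D v"
  proof -
    have dv: "fox_derivative X x (frag_of v) \<in> carrier (group_ring ?F)"
      using v by (simp add: fox_derivative_closed)
    have "?D w = ?D [l] + group_ring_map \<phi>
        (frag_of [l] \<otimes>\<^bsub>group_ring ?F\<^esub> fox_derivative X x (frag_of v))"
      by (simp add: lv fox_derivative_mult_frag_of[OF l v] group_ring_map_def frag_extend_add)
    also have "group_ring_map \<phi> (frag_of [l] \<otimes>\<^bsub>group_ring ?F\<^esub> fox_derivative X x (frag_of v)) =
        group_ring_map \<phi> (frag_of [l]) \<otimes>\<^bsub>group_ring G\<^esub> ?D v"
      using l dv by (intro ring_hom_mult[OF map_hom]) simp_all
    finally show ?thesis by (simp add: group_ring_map_def)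
  qed
  moreover have "frag_of h \<otimes>\<^bsub>group_ring G\<^esub> (frag_of (\<phi> [l]) \<otimes>\<^bsub>group_ring G\<^esub> ?D v) =
      frag_of (h \<otimes>\<^bsub>G\<^esub> \<phi> [l]) \<otimes>\<^bsub>group_ring G\<^esub> ?D v"
    using h l cv R.m_assoc[of "frag_of h" "frag_of (\<phi> [l])" "?D v"] by simp
  ultimately have "frag_of h \<otimes>\<^bsub>group_ring G\<^esub> ?D w = frag_of h \<otimes>\<^bsub>group_ring G\<^esub> ?D [l] +
      frag_of (h \<otimes>\<^bsub>G\<^esub> \<phi> [l]) \<otimes>\<^bsub>group_ring G\<^esub> ?D v"
    by (simp add: group_ring_mult_linear)
  \<comment> \<open>The first edge contributes at \<open>k\<close>, the tail of the positive arc, in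
    both directions. Forwards, D(l) = 1 and \<open>h\<close> is \<open>k\<close>; backwards, D(l) =
    - l and \<open>h\<close> times the image of \<open>l\<close> is \<open>k\<close>.\<close>
  moreover have "frag_of h \<otimes>\<^bsub>group_ring G\<^esub> ?D [l] =
      (if y = x then if s then frag_of k else - frag_of k else 0)"
  proof -
    have "\<phi> [] = \<one>\<^bsub>G\<^esub>" using \<phi>.hom_one by (simp add: free_group_def)
    then show ?thesis
      using h step(3) target
      by (auto simp: l_def fox_derivative_letter[OF step(2)] group_ring_map_def
          frag_extend_minus group_ring_mult_linear frag_of_mult_minus)
  qed
  moreover have "path_flow p (g, x) =
      Poly_Mapping.lookup (frag_of (h \<otimes>\<^bsub>G\<^esub> \<phi> [l]) \<otimes>\<^bsub>group_ring G\<^esub> ?D v) g"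
    using step(4) by (intro Cons.IH v) (simp_all add: target v_def)
  ultimately show ?case
    by (auto simp: e path_flow_Cons lookup_add)
qed

text \<open>The case \<open>h\<close> = 1, where the translation is trivial. Unique existence of the
  path labelled \<open>w\<close> justifies the definite description in
  \<open>word_path\<close>.\<close>

corollary word_flow_eq_lookup_fox_derivative:
  assumes "group G" and \<phi>: "\<phi> \<in> hom (free_group X) G"
    and w: "w \<in> carrier (free_group X)"
  shows "word_flow G X (\<lambda>y. \<phi> (gen y)) w (g, x) =
    Poly_Mapping.lookup (group_ring_map \<phi> (fox_derivative X x (frag_of w))) g"
proof -
  interpret G: group G by fact
  interpret R: ring "group_ring G" by (rule ring_group_ring) fact
  let ?\<iota> = "\<lambda>y. \<phi> (gen y)"
  have "?\<iota> \<in> X \<rightarrow> carrier G"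
    by (auto intro!: hom_in_carrier[OF \<phi>] gen_in_free_group)
  then have "\<exists>!p. is_path_from (cayley_graph G X ?\<iota>) \<one>\<^bsub>G\<^esub> p \<and> path_label p = w"
    using w by (intro word_path_ex1 assms(1)) (auto simp: free_group_def)
  from theI'[OF this] have "word_flow G X ?\<iota> w (g, x) = Poly_Mapping.lookup
      (frag_of \<one>\<^bsub>G\<^esub> \<otimes>\<^bsub>group_ring G\<^esub> group_ring_map \<phi> (fox_derivative X x (frag_of w))) g"
    unfolding word_flow_def word_path_def
    by (intro path_flow_eq_lookup_fox_derivative assms) auto
  moreover have "group_ring_map \<phi> (fox_derivative X x (frag_of w)) \<in> carrier (group_ring G)"
    using w
    by (intro ring_hom_closed[OF group_ring_map_hom[OF group_free_group assms(1,2)]]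
        fox_derivative_closed) simp
  ultimately show ?thesis using R.l_one by simp
qed

theorem lemma2p5:
  fixes X :: "'a set" and N :: "'a word set" and w :: "'a word"
  assumes "finite X"
    and "F = free_group X"
    and "N \<lhd> F"
    and "G = F Mod N"
    and "\<mu> = (\<lambda>v. N #>\<^bsub>F\<^esub> v)"
    and "\<pi> = word_flow G X (\<lambda>x. \<mu> (gen x)) w"
    and "w \<in> carrier F"
  shows "(\<forall>g\<in>carrier G. \<forall>x\<in>X.
            \<pi> (g, x) = Poly_Mapping.lookup (group_ring_map \<mu> (fox_derivative X x (frag_of w))) g) \<and>
         (\<forall>x\<in>X. finite {g \<in> carrier G. \<pi> (g, x) \<noteq> 0} \<and>
            group_ring_map \<mu> (fox_derivative X x (frag_of w)) =
              (\<Sum>g\<in>{g \<in> carrier G. \<pi> (g, x) \<noteq> 0}. frag_cmul (\<pi> (g, x)) (frag_of g)))"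
proof -
  interpret N: normal N F by fact
  have G: "group G" unfolding assms(4) by (rule N.factorgroup_is_group)
  \<comment> \<open>The projection onto cosets is a homomorphism, so the result for a general \<phi>
    applies to it.\<close>
  have \<mu>: "\<mu> \<in> hom (free_group X) G"
    using N.r_coset_hom_Mod by (simp add: assms(2,4,5))
  have w: "w \<in> carrier (free_group X)" using assms(2,7) by simp
  let ?D = "\<lambda>x. group_ring_map \<mu> (fox_derivative X x (frag_of w))"
  have flow: "\<pi> (g, x) = Poly_Mapping.lookup (?D x) g" for g x
    unfolding assms(6) by (rule word_flow_eq_lookup_fox_derivative[OF G \<mu> w])
  have "?D x \<in> carrier (group_ring G)" for x
    using w
    by (intro ring_hom_closed[OF group_ring_map_hom[OF group_free_group G \<mu>]]
        fox_derivative_closed) simp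
  \<comment> \<open>The flow is the coefficient function of an element supported in
    \<open>carrier G\<close>. Its nonzero set is therefore that finite support, and the claimed sum
    is the standard expansion.\<close>
  then have keys: "{g \<in> carrier G. \<pi> (g, x) \<noteq> 0} = Poly_Mapping.keys (?D x)" for x
    by (auto simp: flow group_ring_def in_keys_iff)
  have "?D x = (\<Sum>g\<in>Poly_Mapping.keys (?D x). frag_cmul (\<pi> (g, x)) (frag_of g))" for x
    using frag_expansion[of "?D x"] by (simp add: frag_extend_def flow)
  then show ?thesis unfolding keys by (simp add: flow)
qed

end
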